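(* Let $m\ge2$ be an integer. (i) (Moving arithmetic mean.) If $(y_0,\dots,y_{m-1})\in\mathbb R^m$ and $y_n=\frac1m y_{n-1}+\cdots+\frac1m y_{n-m}$ for all $n\ge m$, then $$y_n\to\frac{2}{m(m+1)}\sum_{j=0}^{m-1}(j+1)y_j .$$ (ii) (Moving geometric mean.) If $(y_0,\dots,y_{m-1})\in\mathbb R_{++}^m$ and $y_{n+m}=\sqrt[m]{y_{n+m-1}\cdots y_n}$ for all $n\ge0$, then $$y_n\to\Big(\prod_{j=0}^{m-1}y_j^{\,j+1}\Big)^{\frac{2}{m(m+1)}} .$$ (iii) (Moving Hölder mean.) If $p>0$, $(y_0,\dots,y_{m-1})\in\mathbb R_+^m$ and $y_{n+m}=\big(\frac1m y_{n+m-1}^p+\cdots+\frac1m y_n^p\big)^{1/p}$ for all $n\ge0$, then $$y_n\to\Big(\frac{2}{m(m+1)}\sum_{j=0}^{m-1}(j+1)y_j^p\Big)^{1/p} .$$ (iv) (Moving harmonic mean.) If $(y_0,\dots,y_{m-1})\in\mathbb R_{++}^m$ and $y_{n+m}=\big(\frac1m\frac1{y_{n+m-1}}+\cdots+\frac1m\frac1{y_n}\big)^{-1}$ for all $n\ge0$, then $$y_n\to\Big(\frac{2}{m(m+1)}\sum_{j=0}^{m-1}(j+1)\frac1{y_j}\Big)^{-1} .$$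
   Context: $\mathbb R_+$ denotes the nonnegative reals and $\mathbb R_{++}$ the positive reals. *)

theory Defs
  imports Complex_Main
begin

end

theory Submission
  imports Defs
begin

text \<open>
  The arithmetic recurrence \<open>m * y (n + m) = y n + \<dots> + y (n + m - 1)\<close> preserves the moment
  \<open>W n = (\<Sum>j<m. (j + 1) * y (n + j))\<close>, because sliding the window by one place changes \<open>W\<close> by
  \<open>m * y (n + m) - (\<Sum>j<m. y (n + j)) = 0\<close>. The weights \<open>j + 1\<close> add up to \<open>m (m + 1) / 2\<close>, so if
  \<open>y\<close> converges at all, its limit is \<open>L = 2 / (m (m + 1)) * W 0\<close>.

  The same invariant yields convergence. After subtracting \<open>L\<close> the moment is \<open>0\<close>, so any multiple
  of it may be subtracted from the recurrence. The multiple \<open>1 / m\<^sup>2\<close> turns the weights \<open>1 / m\<close> into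
  \<open>(m - 1 - j) / m\<^sup>2\<close>, which are still nonnegative but have total \<open>(m - 1) / (2 m) \<le> 1 / 2\<close>.
  Each new term is therefore at most half of the largest of the preceding \<open>m\<close> terms in absolute
  value, and \<open>y n - L\<close> decays geometrically (\<open>halving_window_tendsto_0\<close>,
  \<open>moving_average_tendsto\<close>).

  The geometric, Hoelder and harmonic means are arithmetic means seen through the changes of
  variable \<open>ln\<close>, \<open>x \<mapsto> x powr p\<close> and \<open>inverse\<close>. The transformed sequence obeys the arithmetic
  recurrence, and its limit is carried back by continuity of the inverse transformation
  (\<open>quasi_arithmetic_moving_mean_tendsto\<close>).
\<close>

lemma sum_linear_weights: "(\<Sum>j<m. real j + 1) = real m * (real m + 1) / 2"
  by (induction m) (auto simp: field_simps)

lemma moving_average_moment_invariant: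
  fixes y :: "nat \<Rightarrow> real"
  assumes rec: "\<And>n. real m * y (n + m) = (\<Sum>k<m. y (n + k))"
  shows "(\<Sum>j<m. (real j + 1) * y (n + j)) = (\<Sum>j<m. (real j + 1) * y j)"
proof (induction n)
  case 0
  show ?case by simp
next
  case (Suc n)
  \<comment> \<open>Reindexed by \<open>i = j + 1\<close>, the shifted moment has weights \<open>i\<close> in place of \<open>i + 1\<close>.\<close>
  have "(\<Sum>j<m. (real j + 1) * y (Suc n + j)) = (\<Sum>i<Suc m. real i * y (n + i))"
    by (subst sum.lessThan_Suc_shift) (simp add: add.commute)
  also have "\<dots> = (\<Sum>i<m. real i * y (n + i)) + (\<Sum>i<m. y (n + i))"
    by (simp add: rec)
  also have "\<dots> = (\<Sum>j<m. (real j + 1) * y (n + j))"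
    by (simp add: sum.distrib algebra_simps)
  finally show ?case
    using Suc.IH by simp
qed

text \<open>
  The exponent \<open>n div m\<close> counts the complete blocks of length \<open>m\<close> before \<open>n\<close>. The window before
  \<open>n\<close> reaches back at most one block, so the bound on it is at most twice the bound wanted at \<open>n\<close>,
  and the hypothesis provides exactly this factor.
\<close>
lemma halving_window_tendsto_0:
  fixes x :: "nat \<Rightarrow> real"
  assumes m: "m > 0"
    and halve: "\<And>n B. (\<And>j. j < m \<Longrightarrow> \<bar>x (n + j)\<bar> \<le> B) \<Longrightarrow> \<bar>x (n + m)\<bar> \<le> B / 2"
  shows "x \<longlonglongrightarrow> 0"
proof -
  define C where "C = (\<Sum>j<m. \<bar>x j\<bar>)"
  have C0: "C \<ge> 0"
    unfolding C_def by (intro sum_nonneg) auto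
  have bound: "\<bar>x n\<bar> \<le> C * (1/2) ^ (n div m)" for n
  proof (induction n rule: less_induct)
    case (less n)
    show ?case
    proof (cases "n < m")
      case True
      have "\<bar>x n\<bar> \<le> C"
        unfolding C_def by (rule member_le_sum) (use True in auto)
      then show ?thesis using True by simp
    next
      case False
      have "\<bar>x (n - m + j)\<bar> \<le> C * (1/2) ^ ((n - m) div m)" if "j < m" for j
      proof -
        have "\<bar>x (n - m + j)\<bar> \<le> C * (1/2) ^ ((n - m + j) div m)"
          using False that by (intro less) auto
        also have "\<dots> \<le> C * (1/2) ^ ((n - m) div m)"
          using C0 by (intro mult_left_mono power_decreasing div_le_mono) auto
        finally show ?thesis .
      qed
      from halve[OF this] have "\<bar>x n\<bar> \<le> C * (1/2) ^ ((n - m) div m) / 2"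
        using False by simp
      moreover have "n div m = Suc ((n - m) div m)"
        using False m by (simp add: le_div_geq)
      ultimately show ?thesis by simp
    qed
  qed
  have "filterlim (\<lambda>n. n div m) sequentially sequentially"
  proof (unfold filterlim_at_top eventually_sequentially, intro allI exI impI)
    fix Z n :: nat
    assume "Z * m \<le> n"
    then show "Z \<le> n div m"
      using m by (simp add: less_eq_div_iff_mult_less_eq)
  qed
  then have "(\<lambda>n. (1/2 :: real) ^ (n div m)) \<longlonglongrightarrow> 0"
    by (rule filterlim_compose[rotated]) (simp add: LIMSEQ_realpow_zero)
  then have "(\<lambda>n. C * (1/2) ^ (n div m)) \<longlonglongrightarrow> 0"
    by (rule tendsto_mult_right_zero)
  then show ?thesis
  proof (rule tendsto_0_le)
    show "\<forall>\<^sub>F n in sequentially. norm (x n) \<le> norm (C * (1/2) ^ (n div m)) * 1"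
      using bound C0 by (simp add: abs_mult)
  qed
qed

lemma moving_average_tendsto:
  fixes y :: "nat \<Rightarrow> real"
  assumes m: "m > 0"
    and rec: "\<And>n. y (n + m) = (\<Sum>k<m. 1 / real m * y (n + k))"
  shows "y \<longlonglongrightarrow> 2 / (real m * (real m + 1)) * (\<Sum>j<m. (real j + 1) * y j)"
proof -
  define L where "L = 2 / (real m * (real m + 1)) * (\<Sum>j<m. (real j + 1) * y j)"
  define x where "x n = y n - L" for n
  have yrec: "real m * y (n + m) = (\<Sum>k<m. y (n + k))" for n
    using m by (simp add: rec sum_divide_distrib [symmetric])
  have xrec: "real m * x (n + m) = (\<Sum>k<m. x (n + k))" for n
    using yrec[of n] by (simp add: x_def sum_subtractf algebra_simps)
  have moment0: "(\<Sum>j<m. (real j + 1) * x (n + j)) = 0" for n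
  proof -
    have "(\<Sum>j<m. (real j + 1) * x (n + j))
        = (\<Sum>j<m. (real j + 1) * y (n + j)) - (\<Sum>j<m. real j + 1) * L"
      by (simp add: x_def right_diff_distrib sum_subtractf sum_distrib_right)
    also have "\<dots> = (\<Sum>j<m. (real j + 1) * y j) - real m * (real m + 1) / 2 * L"
      unfolding moving_average_moment_invariant[of m y n, OF yrec] sum_linear_weights ..
    also have "\<dots> = 0"
      using m by (simp add: L_def divide_simps)
    finally show ?thesis .
  qed
  have "\<bar>x (n + m)\<bar> \<le> B / 2" if B: "\<And>j. j < m \<Longrightarrow> \<bar>x (n + j)\<bar> \<le> B" for n B
  proof -
    have B0: "B \<ge> 0"
      using B[of 0] m by linarith
    \<comment> \<open>The recurrence times \<open>m\<close>, minus the vanishing moment.\<close>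
    have "(real m)\<^sup>2 * x (n + m)
        = real m * (\<Sum>j<m. x (n + j)) - (\<Sum>j<m. (real j + 1) * x (n + j))"
      by (simp add: moment0 xrec [symmetric] power2_eq_square)
    also have "\<dots> = (\<Sum>j<m. (real m - (real j + 1)) * x (n + j))"
      by (simp add: sum_distrib_left left_diff_distrib sum_subtractf)
    finally have "(real m)\<^sup>2 * \<bar>x (n + m)\<bar> = \<bar>\<Sum>j<m. (real m - (real j + 1)) * x (n + j)\<bar>"
      by (metis abs_mult abs_of_nonneg zero_le_power2)
    also have "\<dots> \<le> (\<Sum>j<m. (real m - (real j + 1)) * B)"
    proof (rule order_trans[OF sum_abs sum_mono])
      fix j assume "j \<in> {..<m}"
      then have "j < m" by simp
      then have "real m - (real j + 1) \<ge> 0" by linarith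
      then show "\<bar>(real m - (real j + 1)) * x (n + j)\<bar> \<le> (real m - (real j + 1)) * B"
        unfolding abs_mult using B[OF \<open>j < m\<close>] by (simp add: mult_left_mono)
    qed
    also have "\<dots> = ((real m)\<^sup>2 - real m * (real m + 1) / 2) * B"
      by (simp only: sum_distrib_right [symmetric] sum_subtractf sum_linear_weights)
        (simp add: power2_eq_square)
    also have "\<dots> \<le> (real m)\<^sup>2 * (B / 2)"
      using B0 by (simp add: power2_eq_square field_simps)
    finally show ?thesis
      using m by simp
  qed
  then have "x \<longlonglongrightarrow> 0"
    by (rule halving_window_tendsto_0[OF m])
  then have "y \<longlonglongrightarrow> L"
    unfolding x_def by (rule LIM_zero_cancel)
  then show ?thesis
    unfolding L_def .
qed

text \<open>
  The means generated by a function \<open>f\<close>. The left inverse \<open>g\<close> and its continuity are demanded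
  only along the sequence, because \<open>ln\<close> and \<open>x \<mapsto> x powr p\<close> are inverted only on the positive or the
  nonnegative reals, and the inverse \<open>x \<mapsto> x powr (1 / p)\<close> may have to be evaluated at the limit \<open>0\<close>.
\<close>
lemma quasi_arithmetic_moving_mean_tendsto:
  fixes m :: nat and y :: "nat \<Rightarrow> real" and f g :: "real \<Rightarrow> real"
  defines "A \<equiv> 2 / (real m * (real m + 1)) * (\<Sum>j<m. (real j + 1) * f (y j))"
  assumes m: "m > 0"
    and rec: "\<And>n. f (y (n + m)) = (\<Sum>k<m. 1 / real m * f (y (n + k)))"
    and inv: "\<And>n. g (f (y n)) = y n"
    and cont: "(\<lambda>n. f (y n)) \<longlonglongrightarrow> A \<Longrightarrow> (\<lambda>n. g (f (y n))) \<longlonglongrightarrow> g A"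
  shows "y \<longlonglongrightarrow> g A"
proof -
  have "(\<lambda>n. f (y n)) \<longlonglongrightarrow> A"
    unfolding A_def by (rule moving_average_tendsto[OF m rec])
  from cont[OF this] show ?thesis
    by (simp add: inv)
qed

lemma window_recurrence_pos:
  fixes y :: "nat \<Rightarrow> real"
  assumes init: "\<And>j. j < m \<Longrightarrow> y j > 0"
    and step: "\<And>n. (\<And>k. k < m \<Longrightarrow> y (n + k) > 0) \<Longrightarrow> y (n + m) > 0"
  shows "y n > 0"
proof (induction n rule: less_induct)
  case (less n)
  show ?case
  proof (cases "n < m")
    case False
    then show ?thesis
      using step[of "n - m"] less by simp
  qed (rule init)
qed

lemma moving_geometric_mean_tendsto:
  fixes y :: "nat \<Rightarrow> real"
  assumes m: "m > 0" and init: "\<And>j. j < m \<Longrightarrow> y j > 0"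
    and rec: "\<And>n. y (n + m) = root m (\<Prod>k<m. y (n + k))"
  shows "y \<longlonglongrightarrow> (\<Prod>j<m. y j ^ (j + 1)) powr (2 / (real m * (real m + 1)))"
proof -
  have pos: "y n > 0" for n
    by (rule window_recurrence_pos[OF init]) (auto simp: rec m intro!: prod_pos)
  have "y \<longlonglongrightarrow> exp (2 / (real m * (real m + 1)) * (\<Sum>j<m. (real j + 1) * ln (y j)))"
  proof (rule quasi_arithmetic_moving_mean_tendsto[OF m])
    show "ln (y (n + m)) = (\<Sum>k<m. 1 / real m * ln (y (n + k)))" for n
      using m pos by (simp add: rec ln_root prod_pos ln_prod less_imp_neq[symmetric]
          sum_divide_distrib)
    show "exp (ln (y n)) = y n" for n
      using pos by simp
  qed (rule tendsto_exp)
  also have "exp (2 / (real m * (real m + 1)) * (\<Sum>j<m. (real j + 1) * ln (y j)))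
      = (\<Prod>j<m. y j ^ (j + 1)) powr (2 / (real m * (real m + 1)))"
  proof -
    have "ln (\<Prod>j<m. y j ^ (j + 1)) = (\<Sum>j<m. ln (y j ^ (j + 1)))"
      using pos by (intro ln_prod) (auto simp: less_imp_neq[symmetric])
    also have "\<dots> = (\<Sum>j<m. (real j + 1) * ln (y j))"
      by (intro sum.cong) (auto simp: ln_realpow pos add.commute simp del: power_Suc)
    finally have "ln (\<Prod>j<m. y j ^ (j + 1)) = (\<Sum>j<m. (real j + 1) * ln (y j))" .
    moreover have "(\<Prod>j<m. y j ^ (j + 1)) \<noteq> 0"
      using pos by (auto simp: less_imp_neq[symmetric])
    ultimately show ?thesis
      by (simp only: powr_def if_False)
  qed
  finally show ?thesis .
qed

lemma moving_Hoelder_mean_tendsto: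
  fixes y :: "nat \<Rightarrow> real"
  assumes m: "m > 0" and p: "p > 0" and init: "\<And>j. j < m \<Longrightarrow> y j \<ge> 0"
    and rec: "\<And>n. y (n + m) = (\<Sum>k<m. 1 / real m * y (n + k) powr p) powr (1 / p)"
  shows "y \<longlonglongrightarrow> (2 / (real m * (real m + 1)) * (\<Sum>j<m. (real j + 1) * y j powr p)) powr (1 / p)"
proof (rule quasi_arithmetic_moving_mean_tendsto[OF m])
  fix n
  have "(\<Sum>k<m. 1 / real m * y (n + k) powr p) \<ge> 0"
    by (intro sum_nonneg) auto
  then show "y (n + m) powr p = (\<Sum>k<m. 1 / real m * y (n + k) powr p)"
    using p by (simp add: rec[of n] powr_powr)
  have "y n \<ge> 0"
  proof (cases "n < m")
    case False
    then show ?thesis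
      using rec[of "n - m"] by simp
  qed (rule init)
  then show "(y n powr p) powr (1 / p) = y n"
    using p by (simp add: powr_powr)
next
  \<comment> \<open>The limit may be \<open>0\<close>, where \<open>powr\<close> is continuous along nonnegative
    sequences because the exponent is positive.\<close>
  assume "(\<lambda>n. y n powr p) \<longlonglongrightarrow> 2 / (real m * (real m + 1)) * (\<Sum>j<m. (real j + 1) * y j powr p)"
  then show "(\<lambda>n. (y n powr p) powr (1 / p))
      \<longlonglongrightarrow> (2 / (real m * (real m + 1)) * (\<Sum>j<m. (real j + 1) * y j powr p)) powr (1 / p)"
    by (rule tendsto_powr'[OF _ tendsto_const]) (use p in auto)
qed

lemma moving_harmonic_mean_tendsto:
  fixes y :: "nat \<Rightarrow> real"
  assumes m: "m > 0" and init: "\<And>j. j < m \<Longrightarrow> y j > 0"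
    and rec: "\<And>n. y (n + m) = inverse (\<Sum>k<m. 1 / real m * (1 / y (n + k)))"
  shows "y \<longlonglongrightarrow> inverse (2 / (real m * (real m + 1)) * (\<Sum>j<m. (real j + 1) * (1 / y j)))"
proof -
  have pos: "y n > 0" for n
  proof (rule window_recurrence_pos[OF init])
    fix n
    assume "\<And>k. k < m \<Longrightarrow> y (n + k) > 0"
    then show "y (n + m) > 0"
      unfolding rec[of n] using m by (intro positive_imp_inverse_positive sum_pos) auto
  qed
  have "(\<Sum>j<m. (real j + 1) * (1 / y j)) > 0"
    using m pos by (intro sum_pos) (auto simp: add_nonneg_pos)
  then have nz: "2 / (real m * (real m + 1)) * (\<Sum>j<m. (real j + 1) * (1 / y j)) \<noteq> 0"
    using m by auto
  show ?thesis
  proof (rule quasi_arithmetic_moving_mean_tendsto[OF m])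
    show "1 / y (n + m) = (\<Sum>k<m. 1 / real m * (1 / y (n + k)))" for n
      by (simp add: rec[of n] inverse_eq_divide)
    show "inverse (1 / y n) = y n" for n
      by simp
  qed (rule tendsto_inverse[OF _ nz])
qed

theorem corollary5p2:
  fixes m :: nat
  assumes "m \<ge> 2"
  shows
    "(\<forall>y :: nat \<Rightarrow> real.
        (\<forall>n\<ge>m. y n = (\<Sum>k=1..m. 1 / real m * y (n - k))) \<longrightarrow>
        y \<longlonglongrightarrow> 2 / (real m * (real m + 1)) * (\<Sum>j<m. (real j + 1) * y j)) \<and>
     (\<forall>y :: nat \<Rightarrow> real.
        (\<forall>j<m. y j > 0) \<longrightarrow>
        (\<forall>n. y (n + m) = root m (\<Prod>k<m. y (n + k))) \<longrightarrow>
        y \<longlonglongrightarrow> (\<Prod>j<m. y j ^ (j + 1)) powr (2 / (real m * (real m + 1)))) \<and>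
     (\<forall>(p :: real) (y :: nat \<Rightarrow> real).
        p > 0 \<longrightarrow>
        (\<forall>j<m. y j \<ge> 0) \<longrightarrow>
        (\<forall>n. y (n + m) = (\<Sum>k<m. 1 / real m * y (n + k) powr p) powr (1 / p)) \<longrightarrow>
        y \<longlonglongrightarrow> (2 / (real m * (real m + 1)) * (\<Sum>j<m. (real j + 1) * y j powr p)) powr (1 / p)) \<and>
     (\<forall>y :: nat \<Rightarrow> real.
        (\<forall>j<m. y j > 0) \<longrightarrow>
        (\<forall>n. y (n + m) = inverse (\<Sum>k<m. 1 / real m * (1 / y (n + k)))) \<longrightarrow>
        y \<longlonglongrightarrow> inverse (2 / (real m * (real m + 1)) * (\<Sum>j<m. (real j + 1) * (1 / y j))))"
proof -
  have m: "m > 0" using assms by simp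
  show ?thesis
  proof (intro conjI allI impI)
    fix y :: "nat \<Rightarrow> real"
    assume rec: "\<forall>n\<ge>m. y n = (\<Sum>k=1..m. 1 / real m * y (n - k))"
    show "y \<longlonglongrightarrow> 2 / (real m * (real m + 1)) * (\<Sum>j<m. (real j + 1) * y j)"
    proof (rule moving_average_tendsto[OF m])
      fix n
      have "y (n + m) = (\<Sum>k=1..m. 1 / real m * y (n + m - k))"
        using rec by simp
      also have "\<dots> = (\<Sum>k<m. 1 / real m * y (n + k))"
        by (rule sum.reindex_bij_witness[of _ "\<lambda>k. m - k" "\<lambda>k. m - k"]) auto
      finally show "y (n + m) = (\<Sum>k<m. 1 / real m * y (n + k))" .
    qed
  next
    fix y :: "nat \<Rightarrow> real"
    assume "\<forall>j<m. y j > 0" and "\<forall>n. y (n + m) = root m (\<Prod>k<m. y (n + k))"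
    then show "y \<longlonglongrightarrow> (\<Prod>j<m. y j ^ (j + 1)) powr (2 / (real m * (real m + 1)))"
      by (intro moving_geometric_mean_tendsto[OF m]) blast+
  next
    fix p :: real and y :: "nat \<Rightarrow> real"
    assume "p > 0" and "\<forall>j<m. y j \<ge> 0"
      and "\<forall>n. y (n + m) = (\<Sum>k<m. 1 / real m * y (n + k) powr p) powr (1 / p)"
    then show "y \<longlonglongrightarrow>
        (2 / (real m * (real m + 1)) * (\<Sum>j<m. (real j + 1) * y j powr p)) powr (1 / p)"
      by (intro moving_Hoelder_mean_tendsto[OF m]) blast+
  next
    fix y :: "nat \<Rightarrow> real"
    assume "\<forall>j<m. y j > 0"
      and "\<forall>n. y (n + m) = inverse (\<Sum>k<m. 1 / real m * (1 / y (n + k)))"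
    then show "y \<longlonglongrightarrow> inverse (2 / (real m * (real m + 1)) * (\<Sum>j<m. (real j + 1) * (1 / y j)))"
      by (intro moving_harmonic_mean_tendsto[OF m]) blast+
  qed
qed

end
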